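(* Let $(X,\|\cdot\|)$ be a real Banach space, $\varepsilon>0$, and let $f:X\to\overline{\mathbb R}$ be a proper $\varepsilon$-uniformly convex function. Assume that $\breve f$ is proper. Then $\breve f$ is $\varepsilon^+$-uniformly convex.
   Context: $\overline{\mathbb R}=\mathbb R\cup\{-\infty,+\infty\}$. A function $f:X\to\overline{\mathbb R}$ is proper if $f(x)>-\infty$ for all $x$ and $\operatorname{dom}(f)=\{x: f(x)<+\infty\}\neq\emptyset$. A function $f$ is $\varepsilon$-uniformly convex if there is $\delta>0$ such that $f\left(\frac{x+y}{2}\right)\le\frac{f(x)+f(y)}{2}-\delta$ whenever $\|x-y\|\ge\varepsilon$ (no convexity of $f$ is assumed; the inequality is vacuous if $x$ or $y$ is not in $\operatorname{dom}(f)$). It is $\varepsilon^+$-uniformly convex if it is $\varepsilon'$-uniformly convex for every $\varepsilon'>\varepsilon$. $\breve f$ denotes the lower semicontinuous convex envelope of $f$, i.e. the function whose epigraph is the closed convex hull of the epigraph of $f$. *)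

theory Defs
  imports "HOL-Analysis.Analysis"
begin

definition proper :: "('a \<Rightarrow> ereal) \<Rightarrow> bool" where
  "proper f \<longleftrightarrow> (\<forall>x. f x > -\<infinity>) \<and> {x. f x < \<infinity>} \<noteq> {}"

(* In ereal, \<infinity> / 2 = \<infinity>, \<infinity> - ereal \<delta> = \<infinity>, and a sum with a summand \<infinity> is \<infinity>. The inequality
   therefore holds automatically as soon as x or y lies outside the domain of f. *)
definition uniformly_convex :: "real \<Rightarrow> ('a::real_normed_vector \<Rightarrow> ereal) \<Rightarrow> bool" where
  "uniformly_convex \<epsilon> f \<longleftrightarrow>
     (\<exists>\<delta>>0. \<forall>x y. norm (x - y) \<ge> \<epsilon> \<longrightarrow> f (midpoint x y) \<le> (f x + f y) / 2 - ereal \<delta>)"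

definition uniformly_convex_plus :: "real \<Rightarrow> ('a::real_normed_vector \<Rightarrow> ereal) \<Rightarrow> bool" where
  "uniformly_convex_plus \<epsilon> f \<longleftrightarrow> (\<forall>\<epsilon>'>\<epsilon>. uniformly_convex \<epsilon>' f)"

(* The library constant epigraph is for real-valued functions only. *)
definition ereal_epigraph :: "('a \<Rightarrow> ereal) \<Rightarrow> ('a \<times> real) set" where
  "ereal_epigraph f = {(x, t). f x \<le> ereal t}"

(* Existence and uniqueness are shown in ereal_epigraph_lsc_convex_envelope and
   lsc_convex_envelope_unique below. *)
definition lsc_convex_envelope :: "('a::real_normed_vector \<Rightarrow> ereal) \<Rightarrow> 'a \<Rightarrow> ereal" where
  "lsc_convex_envelope f = (THE g. ereal_epigraph g = closure (convex hull (ereal_epigraph f)))"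

lemma ereal_epigraph_inj:
  assumes "ereal_epigraph g = ereal_epigraph h"
  shows "g = h"
proof
  fix x
  have eq: "g x \<le> ereal t \<longleftrightarrow> h x \<le> ereal t" for t
    using assms by (auto simp: ereal_epigraph_def set_eq_iff)
  show "g x = h x"
  proof (rule antisym)
    show "g x \<le> h x" by (rule ereal_le_real) (simp add: eq)
    show "h x \<le> g x" by (rule ereal_le_real) (simp flip: eq)
  qed
qed

lemma closed_convex_hull_ereal_epigraph_mono:
  fixes f :: "'a::real_normed_vector \<Rightarrow> ereal"
  assumes "(x, s) \<in> closure (convex hull (ereal_epigraph f))" and "s \<le> t"
  shows "(x, t) \<in> closure (convex hull (ereal_epigraph f))"
proof -
  let ?E = "ereal_epigraph f" and ?d = "(0::'a, t - s)"
  have "?d + (y, r) \<in> ?E" if "(y, r) \<in> ?E" for y r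
  proof -
    have "f y \<le> ereal r" using that by (simp add: ereal_epigraph_def)
    also have "\<dots> \<le> ereal (t - s + r)" using assms(2) by simp
    finally show ?thesis by (simp add: ereal_epigraph_def)
  qed
  then have "(\<lambda>p. ?d + p) ` ?E \<subseteq> ?E" by auto
  then have "(\<lambda>p. ?d + p) ` (convex hull ?E) \<subseteq> convex hull ?E"
    by (metis convex_hull_translation hull_mono)
  then have "(\<lambda>p. ?d + p) ` closure (convex hull ?E) \<subseteq> closure (convex hull ?E)"
    by (metis closure_translation closure_mono)
  then have "?d + (x, s) \<in> closure (convex hull ?E)" using assms(1) by blast
  then show ?thesis by simp
qed

lemma ex_ereal_epigraph_eq_closed_convex_hull:
  fixes f :: "'a::real_normed_vector \<Rightarrow> ereal"
  shows "ereal_epigraph (\<lambda>x. INF t\<in>{t. (x, t) \<in> closure (convex hull (ereal_epigraph f))}. ereal t)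
    = closure (convex hull (ereal_epigraph f))" (is "ereal_epigraph ?g = ?C")
proof (intro equalityI subsetI)
  fix p assume "p \<in> ereal_epigraph ?g"
  then obtain x t where p: "p = (x, t)" and le: "?g x \<le> ereal t"
    by (auto simp: ereal_epigraph_def)
  have "(x, t + inverse (Suc n)) \<in> ?C" for n
  proof -
    have "?g x < ereal (t + inverse (Suc n))" using le by (rule le_less_trans) simp
    then obtain s where "(x, s) \<in> ?C" "s < t + inverse (Suc n)"
      by (auto simp: INF_less_iff)
    then show ?thesis using closed_convex_hull_ereal_epigraph_mono[of x s f] by simp
  qed
  note mem = this
  have "(\<lambda>n. (x, t + inverse (Suc n))) \<longlonglongrightarrow> (x, t + 0)"
    by (intro tendsto_intros LIMSEQ_inverse_real_of_nat)
  then have "(x, t + 0) \<in> ?C"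
    using closed_sequentially[OF closed_closure, of "\<lambda>n. (x, t + inverse (Suc n))"] mem by blast
  then show "p \<in> ?C" by (simp add: p)
next
  fix p assume "p \<in> ?C"
  then show "p \<in> ereal_epigraph ?g"
    by (cases p) (auto simp: ereal_epigraph_def intro!: INF_lower)
qed

lemma ereal_epigraph_lsc_convex_envelope:
  "ereal_epigraph (lsc_convex_envelope f) = closure (convex hull (ereal_epigraph f))"
proof -
  have "\<exists>!g. ereal_epigraph g = closure (convex hull (ereal_epigraph f))"
    by (metis ex_ereal_epigraph_eq_closed_convex_hull ereal_epigraph_inj)
  then show ?thesis unfolding lsc_convex_envelope_def by (rule theI')
qed

lemma lsc_convex_envelope_unique:
  "ereal_epigraph g = closure (convex hull (ereal_epigraph f)) \<Longrightarrow> g = lsc_convex_envelope f"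
  by (rule ereal_epigraph_inj) (simp add: ereal_epigraph_lsc_convex_envelope)

end

theory Submission
  imports Defs
begin

text \<open>
  Write \<open>C\<close> for the closed convex hull of the epigraph of \<open>f\<close>, that is, the epigraph of the envelope.
  The gain \<open>\<delta>\<close> at a midpoint does not pass to convex combinations directly: \<open>x\<close> and \<open>y\<close> may be
  averages of points \<open>x\<^sub>i\<close> and \<open>y\<^sub>j\<close> of which only a tiny proportion of pairs is \<open>\<epsilon>\<close> apart, and these
  pairs may be very far apart. What saves the argument is that the gain grows with the distance.
  Comparing the midpoint of a segment with the two quarter points shows that doubling the distance
  multiplies the gain by \<open>4\<close> (\<open>uniformly_convex_gain_scaling\<close>). In particular the gain is at least
  linear, and with \<open>\<kappa> = \<delta> / (2\<epsilon>)\<close> one gets, for all \<open>(x, s)\<close> and \<open>(y, t)\<close> in the epigraph of \<open>f\<close>,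
  that the point over the midpoint of \<open>x\<close> and \<open>y\<close> at height
  \<open>(s + t) / 2 - \<kappa> (\<parallel>x - y\<parallel> - \<epsilon>)\<close> lies in \<open>C\<close>: for distances below \<open>\<epsilon>\<close> the correction is
  harmless and convexity of \<open>C\<close> suffices.

  This form of the inequality is stable under closed convex hulls. Its right-hand side is affine in
  the heights and concave in the points, and \<open>C\<close> is closed, convex and closed upwards, so for a fixed
  second point the first points that satisfy it form a closed convex set
  (\<open>midpoint_gain_closed_convex_hull\<close>). It therefore extends to \<open>C\<close> in one variable and then in the
  other. For \<open>\<parallel>x - y\<parallel> \<ge> \<epsilon>' > \<epsilon>\<close> it says that the envelope gains \<open>\<kappa> (\<epsilon>' - \<epsilon>)\<close> at the midpoint.
\<close>

text \<open>
  With bounds on \<open>f x\<close> and \<open>f y\<close> by real numbers instead of the values themselves, all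
  later computations take place in the reals.
\<close>

lemma uniformly_convex_real_bounds:
  fixes f :: "'a::real_normed_vector \<Rightarrow> ereal"
  assumes "uniformly_convex \<epsilon> f"
  obtains \<delta> where "\<delta> > 0"
    and "\<And>x y s t. \<lbrakk>norm (x - y) \<ge> \<epsilon>; f x \<le> ereal s; f y \<le> ereal t\<rbrakk>
           \<Longrightarrow> f (midpoint x y) \<le> ereal ((s + t) / 2 - \<delta>)"
proof -
  obtain \<delta> where "\<delta> > 0"
    and uc: "\<And>x y. norm (x - y) \<ge> \<epsilon> \<Longrightarrow> f (midpoint x y) \<le> (f x + f y) / 2 - ereal \<delta>"
    using assms unfolding uniformly_convex_def by blast
  have "f (midpoint x y) \<le> ereal ((s + t) / 2 - \<delta>)"
    if "norm (x - y) \<ge> \<epsilon>" and s: "f x \<le> ereal s" and t: "f y \<le> ereal t" for x y s t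
  proof -
    have "f x + f y \<le> ereal (s + t)"
      using add_mono[OF s t] by simp
    then have "(f x + f y) / 2 \<le> ereal (s + t) / 2"
      by (intro ereal_divide_right_mono) auto
    then have "(f x + f y) / 2 - ereal \<delta> \<le> ereal ((s + t) / 2) - ereal \<delta>"
      by (intro ereal_minus_mono) auto
    then show ?thesis
      using uc[OF that(1)] by (auto intro: order_trans)
  qed
  with \<open>\<delta> > 0\<close> show thesis by (rule that)
qed

text \<open>
  Let \<open>m\<close> be the midpoint of \<open>x\<close> and \<open>y\<close>, and \<open>p\<close>, \<open>q\<close> the midpoints of \<open>x\<close>, \<open>m\<close> and of \<open>m\<close>, \<open>y\<close>.
  Then \<open>m\<close> is also the midpoint of \<open>p\<close> and \<open>q\<close>. A gain \<open>a\<close> at half the distance, used for \<open>p\<close>,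
  \<open>q\<close> and then \<open>m\<close>, gives \<open>f m \<le> (f x + 2 f m + f y) / 4 - 2a\<close>; solving for \<open>f m\<close>
  turns the gain into \<open>4a\<close>.
\<close>

lemma uniformly_convex_gain_scaling:
  fixes f :: "'a::real_normed_vector \<Rightarrow> ereal"
  assumes "\<epsilon> > 0"
    and gain: "\<And>x y s t. \<lbrakk>norm (x - y) \<ge> \<epsilon>; f x \<le> ereal s; f y \<le> ereal t\<rbrakk>
                \<Longrightarrow> f (midpoint x y) \<le> ereal ((s + t) / 2 - \<delta>)"
    and "norm (x - y) \<ge> 2 ^ n * \<epsilon>" "f x \<le> ereal s" "f y \<le> ereal t"
  shows "f (midpoint x y) \<le> ereal ((s + t) / 2 - 4 ^ n * \<delta>)"
  using assms(3-5)
proof (induction n arbitrary: x y s t)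
  case 0
  then show ?case using gain[of x y s t] by simp
next
  case (Suc n)
  define m where "m = midpoint x y"
  define a where "a = 4 ^ n * \<delta>"
  have IH: "f (midpoint u v) \<le> ereal ((b + c) / 2 - a)"
    if "norm (u - v) \<ge> 2 ^ n * \<epsilon>" "f u \<le> ereal b" "f v \<le> ereal c" for u v b c
    using Suc.IH[OF that] by (simp add: a_def)
  have half: "x - m = (1/2) *\<^sub>R (x - y)" "m - y = (1/2) *\<^sub>R (x - y)"
      "midpoint x m - midpoint m y = (1/2) *\<^sub>R (x - y)"
    by (simp_all add: m_def midpoint_def algebra_simps flip: scaleR_add_left)
  have mid: "midpoint (midpoint x m) (midpoint m y) = m"
    by (simp add: m_def midpoint_def algebra_simps flip: scaleR_add_left)
  have far: "2 ^ n * \<epsilon> \<le> norm (x - m)" "2 ^ n * \<epsilon> \<le> norm (m - y)"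
      "2 ^ n * \<epsilon> \<le> norm (midpoint x m - midpoint m y)"
    using Suc.prems(1) unfolding half by simp_all
  have "norm (x - m) \<le> norm (x - y)"
    unfolding half by simp
  with far(1) have "2 ^ n * \<epsilon> \<le> norm (x - y)"
    by (rule order_trans)
  then have "f m \<le> ereal ((s + t) / 2 - a)"
    unfolding m_def by (rule IH) (fact Suc.prems)+
  then have "f m < \<infinity>" by auto
  then consider "f m = -\<infinity>" | r where "f m = ereal r"
    by (cases "f m") auto
  then show ?case
  proof cases
    case 1
    then show ?thesis by (simp add: m_def)
  next
    case (2 r)
    have "f (midpoint x m) \<le> ereal ((s + r) / 2 - a)"
      using far(1) Suc.prems(2) 2 by (intro IH) auto
    moreover have "f (midpoint m y) \<le> ereal ((r + t) / 2 - a)"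
      using far(2) Suc.prems(3) 2 by (intro IH) auto
    ultimately have "f m \<le> ereal ((((s + r) / 2 - a) + ((r + t) / 2 - a)) / 2 - a)"
      using IH[OF far(3)] unfolding mid by blast
    then have "r \<le> (s + t) / 2 - 4 * a"
      using 2 by (simp add: field_simps)
    then show ?thesis
      using 2 by (simp add: m_def a_def mult.assoc)
  qed
qed

text \<open>
  The power of two is the largest with \<open>2\<^sup>n \<epsilon> \<le> \<parallel>x - y\<parallel>\<close>; by maximality
  \<open>4\<^sup>n \<ge> 2\<^sup>n > \<parallel>x - y\<parallel> / (2\<epsilon>)\<close>, so the quadratic gain dominates a linear one.
\<close>

lemma uniformly_convex_linear_gain:
  fixes f :: "'a::real_normed_vector \<Rightarrow> ereal"
  assumes "\<epsilon> > 0" and "\<delta> > 0"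
    and gain: "\<And>x y s t. \<lbrakk>norm (x - y) \<ge> \<epsilon>; f x \<le> ereal s; f y \<le> ereal t\<rbrakk>
                \<Longrightarrow> f (midpoint x y) \<le> ereal ((s + t) / 2 - \<delta>)"
    and far: "norm (x - y) \<ge> \<epsilon>" and st: "f x \<le> ereal s" "f y \<le> ereal t"
  shows "f (midpoint x y) \<le> ereal ((s + t) / 2 - \<delta> / (2 * \<epsilon>) * norm (x - y))"
proof -
  have "1 \<le> norm (x - y) / \<epsilon>" using far \<open>\<epsilon> > 0\<close> by simp
  moreover obtain N where "norm (x - y) / \<epsilon> < 2 ^ N"
    using real_arch_pow[of 2 "norm (x - y) / \<epsilon>"] by auto
  ultimately obtain n where n: "2 ^ n \<le> norm (x - y) / \<epsilon>" "norm (x - y) / \<epsilon> < 2 ^ (n + 1)"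
    using ex_least_nat_less[of "\<lambda>k. norm (x - y) / \<epsilon> < 2 ^ k" N] by (auto simp: not_less)
  have "\<delta> / (2 * \<epsilon>) * norm (x - y) = norm (x - y) / \<epsilon> / 2 * \<delta>"
    by (simp add: mult.commute)
  also have "\<dots> \<le> 2 ^ n * \<delta>"
    using n(2) \<open>\<delta> > 0\<close> by (intro mult_right_mono) auto
  also have "\<dots> \<le> 4 ^ n * \<delta>"
    using \<open>\<delta> > 0\<close> by (intro mult_right_mono power_mono) auto
  finally have "ereal ((s + t) / 2 - 4 ^ n * \<delta>)
      \<le> ereal ((s + t) / 2 - \<delta> / (2 * \<epsilon>) * norm (x - y))"
    by simp
  moreover have "f (midpoint x y) \<le> ereal ((s + t) / 2 - 4 ^ n * \<delta>)"
    using n(1) \<open>\<epsilon> > 0\<close> st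
    by (intro uniformly_convex_gain_scaling[where f = f, OF \<open>\<epsilon> > 0\<close> gain]) (auto simp: field_simps)
  ultimately show ?thesis by (rule order_trans[rotated])
qed

text \<open>
  The height of the new point is a concave function of \<open>(x, s)\<close>, because the norm enters with a
  negative sign. A convex combination of two points obtained in this way thus lies at or below the point
  obtained from the convex combination, and an upward closed \<open>C\<close> contains the latter as well.
\<close>

lemma midpoint_gain_closed_convex_hull:
  fixes C :: "('a::real_normed_vector \<times> real) set"
  assumes "convex C" "closed C"
    and up: "\<And>x s t. \<lbrakk>(x, s) \<in> C; s \<le> t\<rbrakk> \<Longrightarrow> (x, t) \<in> C"
    and "\<kappa> \<ge> 0"
    and base: "\<And>x s. (x, s) \<in> E
                \<Longrightarrow> (midpoint x y, (s + t) / 2 - \<kappa> * (norm (x - y) - \<epsilon>)) \<in> C"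
    and mem: "(x, s) \<in> closure (convex hull E)"
  shows "(midpoint x y, (s + t) / 2 - \<kappa> * (norm (x - y) - \<epsilon>)) \<in> C"
proof -
  define \<phi> where
    "\<phi> p = (midpoint (fst p) y, (snd p + t) / 2 - \<kappa> * (norm (fst p - y) - \<epsilon>))"
    for p :: "'a \<times> real"
  have "continuous_on UNIV \<phi>"
    unfolding \<phi>_def midpoint_def by (intro continuous_intros) auto
  then have "closed (\<phi> -` C)"
    using \<open>closed C\<close> by (simp add: closed_vimage)
  moreover have "convex (\<phi> -` C)"
  proof (rule convexI)
    fix p q :: "'a \<times> real" and u v :: real
    assume pq: "p \<in> \<phi> -` C" "q \<in> \<phi> -` C" and uv: "0 \<le> u" "0 \<le> v" "u + v = 1"
    obtain x1 s1 where p: "p = (x1, s1)" by (cases p)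
    obtain x2 s2 where q: "q = (x2, s2)" by (cases q)
    have v: "v = 1 - u" using uv by simp
    define h where "h = u * ((s1 + t) / 2 - \<kappa> * (norm (x1 - y) - \<epsilon>))
      + v * ((s2 + t) / 2 - \<kappa> * (norm (x2 - y) - \<epsilon>))"
    have "u *\<^sub>R \<phi> p + v *\<^sub>R \<phi> q \<in> C"
      using pq uv by (intro convexD[OF \<open>convex C\<close>]) auto
    moreover have "u *\<^sub>R midpoint x1 y + v *\<^sub>R midpoint x2 y = midpoint (u *\<^sub>R x1 + v *\<^sub>R x2) y"
    proof -
      have "u *\<^sub>R midpoint x1 y + v *\<^sub>R midpoint x2 y
          = (1/2) *\<^sub>R (u *\<^sub>R x1 + v *\<^sub>R x2 + (u + v) *\<^sub>R y)"
        unfolding midpoint_def by (simp add: scaleR_add_left scaleR_add_right)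
      then show ?thesis by (simp add: uv midpoint_def)
    qed
    then have "u *\<^sub>R \<phi> p + v *\<^sub>R \<phi> q = (midpoint (u *\<^sub>R x1 + v *\<^sub>R x2) y, h)"
      by (simp add: \<phi>_def p q h_def)
    ultimately have "(midpoint (u *\<^sub>R x1 + v *\<^sub>R x2) y, h) \<in> C" by simp
    moreover have "h \<le> (u * s1 + v * s2 + t) / 2
        - \<kappa> * (norm (u *\<^sub>R x1 + v *\<^sub>R x2 - y) - \<epsilon>)"
    proof -
      have "u *\<^sub>R x1 + v *\<^sub>R x2 - y = u *\<^sub>R (x1 - y) + v *\<^sub>R (x2 - y)"
        by (simp add: v algebra_simps)
      then have "norm (u *\<^sub>R x1 + v *\<^sub>R x2 - y) \<le> u * norm (x1 - y) + v * norm (x2 - y)"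
        using norm_triangle_ineq[of "u *\<^sub>R (x1 - y)" "v *\<^sub>R (x2 - y)"] uv by simp
      then have "\<kappa> * norm (u *\<^sub>R x1 + v *\<^sub>R x2 - y)
          \<le> \<kappa> * (u * norm (x1 - y) + v * norm (x2 - y))"
        using \<open>\<kappa> \<ge> 0\<close> by (rule mult_left_mono)
      moreover have "h = (u * s1 + v * s2 + t) / 2
          - \<kappa> * (u * norm (x1 - y) + v * norm (x2 - y)) + \<kappa> * \<epsilon>"
        by (simp add: h_def v field_simps)
      ultimately show ?thesis by (simp add: right_diff_distrib)
    qed
    ultimately show "u *\<^sub>R p + v *\<^sub>R q \<in> \<phi> -` C"
      using up by (simp add: \<phi>_def p q)
  qed
  moreover have "E \<subseteq> \<phi> -` C"
    using base by (auto simp: \<phi>_def)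
  ultimately have "closure (convex hull E) \<subseteq> \<phi> -` C"
    by (intro closure_minimal hull_minimal)
  with mem show ?thesis by (auto simp: \<phi>_def)
qed

theorem theorem1p3:
  fixes f :: "'a::banach \<Rightarrow> ereal" and \<epsilon> :: real
  assumes "\<epsilon> > 0"
    and "proper f"
    and "uniformly_convex \<epsilon> f"
    and "proper (lsc_convex_envelope f)"
  shows "uniformly_convex_plus \<epsilon> (lsc_convex_envelope f)"
proof -
  define g where "g = lsc_convex_envelope f"
  define E where "E = ereal_epigraph f"
  define C where "C = closure (convex hull E)"
  have g_le: "g x \<le> ereal t \<longleftrightarrow> (x, t) \<in> C" for x t
    using ereal_epigraph_lsc_convex_envelope[of f]
    by (auto simp: g_def C_def E_def ereal_epigraph_def set_eq_iff)
  have E_iff: "(x, t) \<in> E \<longleftrightarrow> f x \<le> ereal t" for x t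
    by (simp add: E_def ereal_epigraph_def)
  have "convex C" by (simp add: C_def convex_closure)
  have "closed C" by (simp add: C_def)
  have "E \<subseteq> C"
    unfolding C_def by (meson closure_subset hull_subset order_trans)
  have up: "(x, t) \<in> C" if "(x, s) \<in> C" "s \<le> t" for x s t
    using closed_convex_hull_ereal_epigraph_mono that unfolding C_def E_def by blast

  obtain \<delta> where "\<delta> > 0"
    and gain: "\<And>x y s t. \<lbrakk>norm (x - y) \<ge> \<epsilon>; f x \<le> ereal s; f y \<le> ereal t\<rbrakk>
                \<Longrightarrow> f (midpoint x y) \<le> ereal ((s + t) / 2 - \<delta>)"
    using uniformly_convex_real_bounds[OF assms(3)] by blast
  define \<kappa> where "\<kappa> = \<delta> / (2 * \<epsilon>)"
  have "\<kappa> > 0" using \<open>\<delta> > 0\<close> \<open>\<epsilon> > 0\<close> by (simp add: \<kappa>_def)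

  have EE: "(midpoint x y, (s + t) / 2 - \<kappa> * (norm (x - y) - \<epsilon>)) \<in> C"
    if xs: "(x, s) \<in> E" and yt: "(y, t) \<in> E" for x s y t
  proof (cases "norm (x - y) \<ge> \<epsilon>")
    case True
    have "f (midpoint x y) \<le> ereal ((s + t) / 2 - \<kappa> * norm (x - y))"
      unfolding \<kappa>_def
      using uniformly_convex_linear_gain[where f = f, OF \<open>\<epsilon> > 0\<close> \<open>\<delta> > 0\<close> gain True] xs yt
      by (simp add: E_iff)
    then have "(midpoint x y, (s + t) / 2 - \<kappa> * norm (x - y)) \<in> C"
      using \<open>E \<subseteq> C\<close> E_iff by blast
    then show ?thesis
      by (rule up) (use \<open>\<kappa> > 0\<close> \<open>\<epsilon> > 0\<close> in \<open>simp add: right_diff_distrib\<close>)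
  next
    case False
    have "(1/2) *\<^sub>R (x, s) + (1/2) *\<^sub>R (y, t) \<in> C"
      using xs yt \<open>E \<subseteq> C\<close> by (intro convexD[OF \<open>convex C\<close>]) auto
    then have "(midpoint x y, (s + t) / 2) \<in> C"
      by (simp add: midpoint_def scaleR_add_right add_divide_distrib)
    moreover have "\<kappa> * (norm (x - y) - \<epsilon>) \<le> 0"
      using False \<open>\<kappa> > 0\<close> by (simp add: mult_le_0_iff)
    then have "(s + t) / 2 \<le> (s + t) / 2 - \<kappa> * (norm (x - y) - \<epsilon>)"
      by linarith
    ultimately show ?thesis
      by (rule up)
  qed
  have extend: "(midpoint x y, (s + t) / 2 - \<kappa> * (norm (x - y) - \<epsilon>)) \<in> C"
    if base: "\<And>x s. (x, s) \<in> E
          \<Longrightarrow> (midpoint x y, (s + t) / 2 - \<kappa> * (norm (x - y) - \<epsilon>)) \<in> C"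
      and mem: "(x, s) \<in> C" for x s y t
  proof (rule midpoint_gain_closed_convex_hull)
    show "(x, s) \<in> closure (convex hull E)" using mem by (simp add: C_def)
    show "0 \<le> \<kappa>" using \<open>\<kappa> > 0\<close> by simp
  qed (fact \<open>convex C\<close> \<open>closed C\<close> up base)+
  have CE: "(midpoint x y, (s + t) / 2 - \<kappa> * (norm (x - y) - \<epsilon>)) \<in> C"
    if "(x, s) \<in> C" "(y, t) \<in> E" for x s y t
    using EE[OF _ that(2)] that(1) by (rule extend)
  have CC: "(midpoint x y, (s + t) / 2 - \<kappa> * (norm (x - y) - \<epsilon>)) \<in> C"
    if xs: "(x, s) \<in> C" and yt: "(y, t) \<in> C" for x s y t
  proof -
    \<comment> \<open>The inequality is symmetric, so the second point can be moved to the first place.\<close>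
    have "(midpoint z x, (r + s) / 2 - \<kappa> * (norm (z - x) - \<epsilon>)) \<in> C" if "(z, r) \<in> E" for z r
      using CE[OF xs that] by (simp add: midpoint_sym norm_minus_commute add.commute)
    then have "(midpoint y x, (t + s) / 2 - \<kappa> * (norm (y - x) - \<epsilon>)) \<in> C"
      using yt by (rule extend)
    then show ?thesis by (simp add: midpoint_sym norm_minus_commute add.commute)
  qed

  show ?thesis
    unfolding uniformly_convex_plus_def uniformly_convex_def g_def[symmetric]
  proof (intro allI impI)
    fix \<epsilon>' :: real assume "\<epsilon> < \<epsilon>'"
    define \<delta>' where "\<delta>' = \<kappa> * (\<epsilon>' - \<epsilon>)"
    have "g (midpoint x y) \<le> (g x + g y) / 2 - ereal \<delta>'" if far: "\<epsilon>' \<le> norm (x - y)" for x y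
    proof (cases "g x = \<infinity> \<or> g y = \<infinity>")
      case True
      then show ?thesis by auto
    next
      case False
      have "g x > -\<infinity>" "g y > -\<infinity>"
        using assms(4) by (simp_all add: proper_def g_def)
      with False obtain s t where st: "g x = ereal s" "g y = ereal t"
        by (cases "g x"; cases "g y") auto
      have "g (midpoint x y) \<le> ereal ((s + t) / 2 - \<kappa> * (norm (x - y) - \<epsilon>))"
        using CC[of x s y t] st by (simp flip: g_le)
      also have "\<dots> \<le> ereal ((s + t) / 2 - \<delta>')"
        using far \<open>\<kappa> > 0\<close> by (simp add: \<delta>'_def)
      finally show ?thesis by (simp add: st)
    qed
    moreover have "\<delta>' > 0"
      using \<open>\<epsilon> < \<epsilon>'\<close> \<open>\<kappa> > 0\<close> by (simp add: \<delta>'_def)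
    ultimately show "\<exists>\<delta>>0. \<forall>x y. \<epsilon>' \<le> norm (x - y)
        \<longrightarrow> g (midpoint x y) \<le> (g x + g y) / 2 - ereal \<delta>"
      by blast
  qed
qed

end
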